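(* Let $N\ge 1$ and let $\mu$ be a Borel probability measure on $\mathbb{R}^N$. Then $\mu$ is a probabilistic frame if and only if $\mu\in\mathcal{P}_2$ and $E_\mu=\mathbb{R}^N$. Moreover, if $\mu$ is a tight probabilistic frame, then its frame bound $A$ is given by $A=\frac{1}{N}M_2^2(\mu)=\frac{1}{N}\int_{\mathbb{R}^N}\|y\|^2\,d\mu(y)$.
   Context: $\mathbb{R}^N$ carries the standard Euclidean inner product $\langle\cdot,\cdot\rangle$ and norm $\|\cdot\|$. A Borel probability measure $\mu$ on $\mathbb{R}^N$ is a probabilistic frame if there exist constants $0<A\le B<\infty$ such that $A\|x\|^2\le\int_{\mathbb{R}^N}|\langle x,y\rangle|^2\,d\mu(y)\le B\|x\|^2$ for all $x\in\mathbb{R}^N$; $A$ and $B$ are called lower and upper (probabilistic) frame bounds. It is a tight probabilistic frame, with frame bound $A$, if one can take $A=B$. For a Borel probability measure $\mu$, $M_2^2(\mu):=\int_{\mathbb{R}^N}\|x\|^2\,d\mu(x)$ (that is, $M_2(\mu)$ is the nonnegative square root of this quantity), and $\mathcal{P}_2$ is the set of all Borel probability measures $\mu$ on $\mathbb{R}^N$ with $M_2^2(\mu)<\infty$. The support is $\operatorname{supp}(\mu)=\{x\in\mathbb{R}^N:\mu(U)>0\text{ for every open }U\ni x\}$, and $E_\mu$ denotes the linear span of $\operatorname{supp}(\mu)$ in $\mathbb{R}^N$. *)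

theory Defs
  imports "HOL-Probability.Probability"
begin

definition borel_prob :: "'a::euclidean_space measure \<Rightarrow> bool" where
  "borel_prob \<mu> \<longleftrightarrow> prob_space \<mu> \<and> sets \<mu> = sets borel"

(* The integrals of nonnegative functions below are extended-nonnegative-real Lebesgue
   integrals, so a divergent integral has value \<infinity>; the Bochner integral would silently
   be 0 in that case. *)

definition frame_bounds :: "'a::euclidean_space measure \<Rightarrow> real \<Rightarrow> real \<Rightarrow> bool" where
  "frame_bounds \<mu> A B \<longleftrightarrow> 0 < A \<and> A \<le> B \<and>
     (\<forall>x. ennreal (A * (norm x)\<^sup>2) \<le> (\<integral>\<^sup>+ y. ennreal (\<bar>x \<bullet> y\<bar>\<^sup>2) \<partial>\<mu>) \<and>
          (\<integral>\<^sup>+ y. ennreal (\<bar>x \<bullet> y\<bar>\<^sup>2) \<partial>\<mu>) \<le> ennreal (B * (norm x)\<^sup>2))"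

definition probabilistic_frame :: "'a::euclidean_space measure \<Rightarrow> bool" where
  "probabilistic_frame \<mu> \<longleftrightarrow> borel_prob \<mu> \<and> (\<exists>A B. frame_bounds \<mu> A B)"

definition tight_probabilistic_frame :: "'a::euclidean_space measure \<Rightarrow> real \<Rightarrow> bool" where
  "tight_probabilistic_frame \<mu> A \<longleftrightarrow> borel_prob \<mu> \<and> frame_bounds \<mu> A A"

(* The square of M_2, with value \<infinity> when the integral diverges. *)
definition M2_squared :: "'a::euclidean_space measure \<Rightarrow> ennreal" where
  "M2_squared \<mu> = (\<integral>\<^sup>+ x. ennreal ((norm x)\<^sup>2) \<partial>\<mu>)"

definition P2 :: "'a::euclidean_space measure set" where
  "P2 = {\<mu>. borel_prob \<mu> \<and> M2_squared \<mu> < \<infinity>}"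

definition measure_support :: "'a::euclidean_space measure \<Rightarrow> 'a set" where
  "measure_support \<mu> = {x. \<forall>U. open U \<and> x \<in> U \<longrightarrow> emeasure \<mu> U > 0}"

end

theory Submission
  imports Defs
begin

text \<open>
  Everything is read off from the quadratic form
  \<open>Q x = (\<integral>\<^sup>+ y. ennreal (\<bar>x \<bullet> y\<bar>\<^sup>2) \<partial>\<mu>)\<close>.

  Its trace over an orthonormal basis is the second moment, by Parseval's identity under the
  integral (\<open>M2_squared_eq_sum_Basis\<close>). Hence an upper frame bound makes the second moment
  finite; and for a tight frame every basis vector contributes exactly \<open>A\<close> to the trace,
  so \<open>M2_squared \<mu> = N A\<close>. Conversely, by Cauchy--Schwarz the second moment is itself
  an upper frame bound as soon as it is finite.

  The lower bound is governed by the kernel of \<open>Q\<close>, which is the orthogonal complement of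
  the support (\<open>frame_form_eq_0_iff\<close>): the integral vanishes iff \<open>\<mu>\<close> gives no mass to the
  open set of points not orthogonal to \<open>x\<close>, and an open set is null iff it misses the
  support. So \<open>Q\<close> is positive definite iff the support spans. A lower frame bound clearly
  forces this; conversely, when the second moment is finite, \<open>Q\<close> is continuous, so a positive
  definite \<open>Q\<close> attains a positive minimum on the compact unit sphere, and this minimum is a
  lower frame bound by homogeneity.
\<close>

section \<open>Null open sets and the support\<close>

text \<open>The only point is to pass from local to global nullity: an open set that misses the support
  is covered by the null open neighbourhoods of its points, and by the Lindelof property countably
  many of them suffice.\<close>

lemma open_null_iff_disjoint_measure_support:
  fixes \<mu> :: "'a::euclidean_space measure"
  assumes sets: "sets \<mu> = sets borel" and "open U"
  shows "emeasure \<mu> U = 0 \<longleftrightarrow> U \<inter> measure_support \<mu> = {}"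
proof
  assume "emeasure \<mu> U = 0"
  then show "U \<inter> measure_support \<mu> = {}"
    using \<open>open U\<close> by (auto simp: measure_support_def)
next
  assume disj: "U \<inter> measure_support \<mu> = {}"
  define \<F> where "\<F> = {V. open V \<and> emeasure \<mu> V = 0}"
  have "open V" if "V \<in> \<F>" for V
    using that by (simp add: \<F>_def)
  then obtain \<C> where \<C>: "\<C> \<subseteq> \<F>" "countable \<C>" "\<Union>\<C> = \<Union>\<F>"
    by (rule Lindelof)
  have "U \<subseteq> \<Union>\<F>"
  proof
    fix x
    assume "x \<in> U"
    with disj have "x \<notin> measure_support \<mu>"
      by blast
    then show "x \<in> \<Union>\<F>"
      by (auto simp: measure_support_def \<F>_def not_gr_zero)
  qed
  have "V \<in> null_sets \<mu>" if "V \<in> \<C>" for V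
    using subsetD[OF \<C>(1) that] by (intro null_setsI) (simp_all add: \<F>_def sets)
  then have "(\<Union>V\<in>\<C>. V) \<in> null_sets \<mu>"
    by (rule null_sets_UN'[OF \<C>(2)])
  moreover have "U \<in> sets \<mu>"
    using \<open>open U\<close> by (simp add: sets)
  ultimately have "U \<in> null_sets \<mu>"
    using \<open>U \<subseteq> \<Union>\<F>\<close> \<C>(3) null_sets_subset[of "\<Union>V\<in>\<C>. V" \<mu> U] by simp
  then show "emeasure \<mu> U = 0"
    by (rule null_setsD1)
qed

section \<open>The frame form: trace and kernel\<close>

lemma borel_measurable_sq_inner:
  fixes \<mu> :: "'a::euclidean_space measure"
  assumes "sets \<mu> = sets borel"
  shows "(\<lambda>y. \<bar>x \<bullet> y\<bar>\<^sup>2) \<in> borel_measurable \<mu>"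
  unfolding measurable_cong_sets[OF assms refl] by measurable

text \<open>Working in \<open>ennreal\<close> lets one identity serve both to derive finiteness of the second moment
  from an upper frame bound and to evaluate it for a tight frame.\<close>

lemma M2_squared_eq_sum_Basis:
  fixes \<mu> :: "'a::euclidean_space measure"
  assumes "sets \<mu> = sets borel"
  shows "M2_squared \<mu> = (\<Sum>b\<in>Basis. \<integral>\<^sup>+ y. ennreal (\<bar>b \<bullet> y\<bar>\<^sup>2) \<partial>\<mu>)"
proof -
  have "(norm y)\<^sup>2 = (\<Sum>b\<in>Basis. \<bar>b \<bullet> y\<bar>\<^sup>2)" for y :: 'a
    unfolding power2_norm_eq_inner euclidean_inner[of y y]
    by (simp add: power2_eq_square inner_commute)
  then have "ennreal ((norm y)\<^sup>2) = (\<Sum>b\<in>Basis. ennreal (\<bar>b \<bullet> y\<bar>\<^sup>2))" for y :: 'a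
    by (simp add: sum_ennreal)
  then have "M2_squared \<mu> = (\<integral>\<^sup>+ y. (\<Sum>b\<in>Basis. ennreal (\<bar>b \<bullet> y\<bar>\<^sup>2)) \<partial>\<mu>)"
    by (simp add: M2_squared_def)
  also have "\<dots> = (\<Sum>b\<in>Basis. \<integral>\<^sup>+ y. ennreal (\<bar>b \<bullet> y\<bar>\<^sup>2) \<partial>\<mu>)"
    by (intro nn_integral_sum measurable_compose[OF borel_measurable_sq_inner[OF assms]]
        measurable_ennreal)
  finally show ?thesis .
qed

text \<open>The non-orthogonal points form an open set, so its nullity is a statement about the
  support alone.\<close>

lemma frame_form_eq_0_iff:
  fixes \<mu> :: "'a::euclidean_space measure"
  assumes sets: "sets \<mu> = sets borel"
  shows "(\<integral>\<^sup>+ y. ennreal (\<bar>x \<bullet> y\<bar>\<^sup>2) \<partial>\<mu>) = 0 \<longleftrightarrow> (\<forall>y\<in>measure_support \<mu>. x \<bullet> y = 0)"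
proof -
  define U where "U = {y. x \<bullet> y \<noteq> 0}"
  have "open U"
    unfolding U_def by (intro open_Collect_neq continuous_intros)
  have space: "space \<mu> = UNIV"
    using sets_eq_imp_space_eq[OF sets] by simp
  have "(\<integral>\<^sup>+ y. ennreal (\<bar>x \<bullet> y\<bar>\<^sup>2) \<partial>\<mu>) = 0 \<longleftrightarrow> (AE y in \<mu>. x \<bullet> y = 0)"
    using borel_measurable_sq_inner[OF sets, of x] by (subst nn_integral_0_iff_AE) auto
  also have "\<dots> \<longleftrightarrow> emeasure \<mu> U = 0"
    using \<open>open U\<close> sets space by (subst AE_iff_measurable[of U]) (auto simp: U_def)
  also have "\<dots> \<longleftrightarrow> U \<inter> measure_support \<mu> = {}"
    by (rule open_null_iff_disjoint_measure_support[OF sets \<open>open U\<close>])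
  finally show ?thesis
    by (auto simp: U_def)
qed

lemma frame_form_definite_iff_span:
  fixes \<mu> :: "'a::euclidean_space measure"
  assumes "sets \<mu> = sets borel"
  shows "(\<forall>x. (\<integral>\<^sup>+ y. ennreal (\<bar>x \<bullet> y\<bar>\<^sup>2) \<partial>\<mu>) = 0 \<longrightarrow> x = 0)
    \<longleftrightarrow> span (measure_support \<mu>) = UNIV"
  unfolding frame_form_eq_0_iff[OF assms]
proof
  assume definite: "\<forall>x. (\<forall>y\<in>measure_support \<mu>. x \<bullet> y = 0) \<longrightarrow> x = 0"
  show "span (measure_support \<mu>) = UNIV"
  proof (rule ccontr)
    assume "span (measure_support \<mu>) \<noteq> UNIV"
    then obtain a where "a \<noteq> 0" "\<forall>y\<in>span (measure_support \<mu>). a \<bullet> y = 0"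
      using span_not_UNIV_orthogonal by blast
    then show False
      using definite span_base by blast
  qed
next
  assume "span (measure_support \<mu>) = UNIV"
  then show "\<forall>x. (\<forall>y\<in>measure_support \<mu>. x \<bullet> y = 0) \<longrightarrow> x = 0"
    by (metis UNIV_I inner_eq_zero_iff orthogonal_def orthogonal_to_span)
qed

section \<open>Frame bounds from a finite second moment\<close>

lemma P2_integrable_sq_norm:
  assumes "\<mu> \<in> P2"
  shows "integrable \<mu> (\<lambda>y. (norm y)\<^sup>2)"
proof -
  have sets: "sets \<mu> = sets borel" and "M2_squared \<mu> < \<infinity>"
    using assms by (simp_all add: P2_def borel_prob_def)
  then show ?thesis
    by (simp add: M2_squared_def integrable_iff_bounded measurable_cong_sets[OF sets refl])
qed

lemma sq_inner_le: "\<bar>x \<bullet> y\<bar>\<^sup>2 \<le> (norm x)\<^sup>2 * (norm y)\<^sup>2"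
  using power_mono[OF Cauchy_Schwarz_ineq2[of x y], of 2] by (simp add: power_mult_distrib)

lemma P2_integrable_sq_inner:
  assumes "\<mu> \<in> P2"
  shows "integrable \<mu> (\<lambda>y. \<bar>x \<bullet> y\<bar>\<^sup>2)"
proof (rule Bochner_Integration.integrable_bound)
  show "integrable \<mu> (\<lambda>y. (norm x)\<^sup>2 * (norm y)\<^sup>2)"
    using P2_integrable_sq_norm[OF assms] by simp
  show "(\<lambda>y. \<bar>x \<bullet> y\<bar>\<^sup>2) \<in> borel_measurable \<mu>"
    using assms by (intro borel_measurable_sq_inner) (auto simp: P2_def borel_prob_def)
  show "AE y in \<mu>. norm (\<bar>x \<bullet> y\<bar>\<^sup>2) \<le> norm ((norm x)\<^sup>2 * (norm y)\<^sup>2)"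
    using sq_inner_le[of x] by simp
qed

text \<open>On the unit sphere \<open>(norm y)\<^sup>2\<close> is an integrable majorant of all the integrands, so
  dominated convergence applies.\<close>

lemma continuous_on_sphere_frame_form:
  fixes \<mu> :: "'a::euclidean_space measure"
  assumes "\<mu> \<in> P2"
  shows "continuous_on (sphere 0 1) (\<lambda>x. \<integral>y. \<bar>x \<bullet> y\<bar>\<^sup>2 \<partial>\<mu>)"
  unfolding continuous_on_sequentially
proof (intro ballI allI impI, elim conjE)
  fix u :: "nat \<Rightarrow> 'a" and x
  assume u: "\<forall>n. u n \<in> sphere 0 1" "u \<longlonglongrightarrow> x"
  have sets: "sets \<mu> = sets borel"
    using assms by (auto simp: P2_def borel_prob_def)
  have "(\<lambda>n. \<integral>y. \<bar>u n \<bullet> y\<bar>\<^sup>2 \<partial>\<mu>) \<longlonglongrightarrow> (\<integral>y. \<bar>x \<bullet> y\<bar>\<^sup>2 \<partial>\<mu>)"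
  proof (rule integral_dominated_convergence[where w = "\<lambda>y. (norm y)\<^sup>2"])
    show "AE y in \<mu>. (\<lambda>n. \<bar>u n \<bullet> y\<bar>\<^sup>2) \<longlonglongrightarrow> \<bar>x \<bullet> y\<bar>\<^sup>2"
    proof (rule AE_I2)
      fix y
      show "(\<lambda>n. \<bar>u n \<bullet> y\<bar>\<^sup>2) \<longlonglongrightarrow> \<bar>x \<bullet> y\<bar>\<^sup>2"
        by (intro tendsto_power tendsto_rabs tendsto_inner u(2) tendsto_const)
    qed
    show "AE y in \<mu>. norm (\<bar>u n \<bullet> y\<bar>\<^sup>2) \<le> (norm y)\<^sup>2" for n
      using u(1) sq_inner_le[of "u n"] by simp
  qed (rule P2_integrable_sq_norm[OF assms] borel_measurable_sq_inner[OF sets])+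
  then show "((\<lambda>x. \<integral>y. \<bar>x \<bullet> y\<bar>\<^sup>2 \<partial>\<mu>) \<circ> u) \<longlonglongrightarrow> (\<integral>y. \<bar>x \<bullet> y\<bar>\<^sup>2 \<partial>\<mu>)"
    by (simp add: o_def)
qed

text \<open>The minimum of the form over the compact unit sphere is positive by definiteness, and
  homogeneity spreads this lower bound to all vectors. The second moment is the upper bound.\<close>

lemma P2_definite_imp_frame_bounds:
  fixes \<mu> :: "'a::euclidean_space measure"
  assumes \<mu>: "\<mu> \<in> P2"
    and definite: "\<And>x. (\<integral>\<^sup>+ y. ennreal (\<bar>x \<bullet> y\<bar>\<^sup>2) \<partial>\<mu>) = 0 \<Longrightarrow> x = 0"
  shows "\<exists>A B. frame_bounds \<mu> A B"
proof -
  define Q where "Q x = (\<integral>y. \<bar>x \<bullet> y\<bar>\<^sup>2 \<partial>\<mu>)" for x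
  define M where "M = (\<integral>y. (norm y)\<^sup>2 \<partial>\<mu>)"
  have nn_Q: "(\<integral>\<^sup>+ y. ennreal (\<bar>x \<bullet> y\<bar>\<^sup>2) \<partial>\<mu>) = ennreal (Q x)" for x
    unfolding Q_def by (intro nn_integral_eq_integral P2_integrable_sq_inner[OF \<mu>]) auto
  have Q_le: "Q x \<le> M * (norm x)\<^sup>2" for x
  proof -
    have "Q x \<le> (\<integral>y. (norm x)\<^sup>2 * (norm y)\<^sup>2 \<partial>\<mu>)"
      unfolding Q_def
      by (intro integral_mono P2_integrable_sq_inner[OF \<mu>] integrable_mult_right
          P2_integrable_sq_norm[OF \<mu>] sq_inner_le)
    then show ?thesis
      by (simp add: M_def mult.commute)
  qed
  have Q_scale: "Q (c *\<^sub>R x) = c\<^sup>2 * Q x" for c x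
    by (simp add: Q_def power_mult_distrib)
  have "sphere (0::'a) 1 \<noteq> {}"
    by simp
  then obtain x0 where x0: "norm x0 = 1" and min: "\<And>x. norm x = 1 \<Longrightarrow> Q x0 \<le> Q x"
    using continuous_attains_inf[OF compact_sphere _ continuous_on_sphere_frame_form[OF \<mu>]]
    unfolding Q_def by (auto simp: dist_norm)
  have "0 < Q x0"
  proof (rule ccontr)
    assume "\<not> 0 < Q x0"
    \<comment> \<open>the coercion to \<open>ennreal\<close> truncates at zero, so nonpositivity alone makes the form vanish\<close>
    then have "x0 = 0"
      by (intro definite) (simp only: nn_Q ennreal_eq_0_iff not_less)
    with x0 show False by simp
  qed
  \<comment> \<open>the two bounds are compatible because both are tested on the unit vector \<open>x0\<close>\<close>
  moreover have "Q x0 \<le> M"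
    using Q_le[of x0] x0 by simp
  moreover have "Q x0 * (norm x)\<^sup>2 \<le> Q x" for x
  proof (cases "x = 0")
    case True
    then show ?thesis by (simp add: Q_def)
  next
    case False
    then have "Q x = (norm x)\<^sup>2 * Q (x /\<^sub>R norm x)"
      using Q_scale[of "norm x" "x /\<^sub>R norm x"] by simp
    moreover have "Q x0 \<le> Q (x /\<^sub>R norm x)"
      using False by (intro min) simp
    ultimately show ?thesis
      using mult_left_mono[of "Q x0" "Q (x /\<^sub>R norm x)" "(norm x)\<^sup>2"]
      by (simp add: mult.commute)
  qed
  ultimately have "frame_bounds \<mu> (Q x0) M"
    unfolding frame_bounds_def nn_Q using Q_le by (auto intro: ennreal_leI)
  then show ?thesis by blast
qed

section \<open>Characterization of frames and the tight frame bound\<close>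

lemma probabilistic_frame_imp_P2:
  fixes \<mu> :: "'a::euclidean_space measure"
  assumes "probabilistic_frame \<mu>"
  shows "\<mu> \<in> P2"
proof -
  obtain A B where "borel_prob \<mu>" and AB: "frame_bounds \<mu> A B"
    using assms by (auto simp: probabilistic_frame_def)
  then have sets: "sets \<mu> = sets borel"
    by (simp add: borel_prob_def)
  have "(\<integral>\<^sup>+ y. ennreal (\<bar>b \<bullet> y\<bar>\<^sup>2) \<partial>\<mu>) < \<infinity>" for b
    using AB unfolding frame_bounds_def
    by (metis ennreal_less_top infinity_ennreal_def order_le_less_trans)
  then have "M2_squared \<mu> < \<infinity>"
    by (simp add: M2_squared_eq_sum_Basis[OF sets])
  with \<open>borel_prob \<mu>\<close> show ?thesis
    by (simp add: P2_def)
qed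

lemma frame_bounds_imp_definite:
  assumes "frame_bounds \<mu> A B" "(\<integral>\<^sup>+ y. ennreal (\<bar>x \<bullet> y\<bar>\<^sup>2) \<partial>\<mu>) = 0"
  shows "x = 0"
proof -
  have "0 < A" "ennreal (A * (norm x)\<^sup>2) \<le> 0"
    using assms unfolding frame_bounds_def by metis+
  then show ?thesis
    by (auto simp: ennreal_eq_0_iff mult_le_0_iff)
qed

lemma probabilistic_frame_iff:
  fixes \<mu> :: "'a::euclidean_space measure"
  assumes "borel_prob \<mu>"
  shows "probabilistic_frame \<mu> \<longleftrightarrow> \<mu> \<in> P2 \<and> span (measure_support \<mu>) = UNIV"
proof -
  have sets: "sets \<mu> = sets borel"
    using assms by (simp add: borel_prob_def)
  show ?thesis
    unfolding frame_form_definite_iff_span[OF sets, symmetric]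
    using assms probabilistic_frame_imp_P2 frame_bounds_imp_definite P2_definite_imp_frame_bounds
    by (metis probabilistic_frame_def)
qed

lemma tight_probabilistic_frame_M2_squared:
  fixes \<mu> :: "'a::euclidean_space measure"
  assumes "tight_probabilistic_frame \<mu> A"
  shows "M2_squared \<mu> = ennreal (real DIM('a) * A)"
proof -
  have sets: "sets \<mu> = sets borel" and A: "frame_bounds \<mu> A A" "0 \<le> A"
    using assms by (auto simp: tight_probabilistic_frame_def borel_prob_def frame_bounds_def)
  have "(\<integral>\<^sup>+ y. ennreal (\<bar>b \<bullet> y\<bar>\<^sup>2) \<partial>\<mu>) = ennreal A" if "b \<in> Basis" for b
  proof -
    have "(\<integral>\<^sup>+ y. ennreal (\<bar>b \<bullet> y\<bar>\<^sup>2) \<partial>\<mu>) = ennreal (A * (norm b)\<^sup>2)"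
      using A(1) unfolding frame_bounds_def by (metis order_antisym)
    then show ?thesis
      using that by simp
  qed
  then have "M2_squared \<mu> = of_nat DIM('a) * ennreal A"
    by (simp add: M2_squared_eq_sum_Basis[OF sets])
  then show ?thesis
    using A(2) by (simp add: ennreal_mult ennreal_of_nat_eq_real_of_nat)
qed

theorem theorem1:
  fixes \<mu> :: "(real ^ 'n) measure"
  assumes "borel_prob \<mu>"
  shows "(probabilistic_frame \<mu> \<longleftrightarrow> \<mu> \<in> P2 \<and> span (measure_support \<mu>) = UNIV) \<and>
    (\<forall>A. tight_probabilistic_frame \<mu> A \<longrightarrow>
       ennreal A = ennreal (1 / real CARD('n)) * M2_squared \<mu> \<and>
       A = 1 / real CARD('n) * (\<integral>y. (norm y)\<^sup>2 \<partial>\<mu>))"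
proof (intro conjI allI impI)
  show "probabilistic_frame \<mu> \<longleftrightarrow> \<mu> \<in> P2 \<and> span (measure_support \<mu>) = UNIV"
    by (rule probabilistic_frame_iff[OF assms])
next
  fix A
  assume tight: "tight_probabilistic_frame \<mu> A"
  then have "0 \<le> A"
    by (simp add: tight_probabilistic_frame_def frame_bounds_def)
  have sets: "sets \<mu> = sets borel"
    using assms by (simp add: borel_prob_def)
  have M2: "M2_squared \<mu> = ennreal (real CARD('n) * A)"
    using tight_probabilistic_frame_M2_squared[OF tight] by simp
  then show "ennreal A = ennreal (1 / real CARD('n)) * M2_squared \<mu>"
    using \<open>0 \<le> A\<close> by (simp flip: ennreal_mult)
  have "(\<integral>y. (norm y)\<^sup>2 \<partial>\<mu>) = enn2real (M2_squared \<mu>)"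
    unfolding M2_squared_def
    by (intro integral_eq_nn_integral) (simp_all add: measurable_cong_sets[OF sets refl])
  then show "A = 1 / real CARD('n) * (\<integral>y. (norm y)\<^sup>2 \<partial>\<mu>)"
    using M2 \<open>0 \<le> A\<close> by simp
qed

end
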